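(* Assume that for every nonempty $S\subseteq\mathcal U$ there exists $x\in S$ with $|\mathcal N_x\cap S|\le1$, that $|\mathcal N_x|=2d$ for every $x\in\mathcal U$, and that $f\colon\mathcal U\to(0,\infty)$. Let $g\colon\mathcal O\to\mathbb R$, and let $b$, $B$, $\|\cdot\|_b$ be the barrier function, its maximum on $\mathcal U$, and the associated norm, as defined in the context. Then the map $T_f$ satisfies $$\|T_f[u]-T_f[v]\|_b\le\Bigl(1-\frac1B\Bigr)\|u-v\|_b$$ for all $u,v\colon\mathcal X\to\mathbb R$ with $u=v=g$ on $\mathcal O$. Consequently, for every $0<\omega\le1$ and every initial datum $u^0\colon\mathcal X\to\mathbb R$ satisfying $u^0=g$ on $\mathcal O$, the iteration $$u^{m+1}(x)=(1-\omega)u^m(x)+\omega T_f[u^m](x)\ \ (x\in\mathcal U),\qquad u^{m+1}(x)=g(x)\ \ (x\in\mathcal O),$$ converges to the unique fixed point $u^\ast$ of $T_f$, equivalently to the unique solution of $$\begin{cases}\displaystyle\prod_{i=1}^d\bigl(H_i[u](x)-u(x)\bigr)=f(x),&x\in\mathcal U,\\ u(x)=g(x),&x\in\mathcal O,\end{cases}$$ that is strictly graph convex on $\mathcal U$. Moreover, for all $m\ge0$, $$\|u^m-u^\ast\|_b\le\Bigl(1-\frac\omega B\Bigr)^m\|u^0-u^\ast\|_b.$$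
   Context: $\mathcal G=(\mathcal X,E)$ is a finite simple undirected graph, $\mathcal O\subseteq\mathcal X$, $\mathcal U=\mathcal X\setminus\mathcal O$ (nonempty), $\mathcal N_x$ is the set of neighbors of $x$, and $d\ge1$ is an integer. For $u\colon\mathcal X\to\mathbb R$, $x\in\mathcal U$, $i\in\{1,\dots,d\}$, $$H_i[u](x)=\min_{\substack{S\subseteq\mathcal N_x\\ |S|=2i}}\ \max_{\substack{y,z\in S\\ y\ne z}}\frac{u(y)+u(z)}2,$$ so that $H_1[u](x)\le\dots\le H_d[u](x)$; if $u(y_1)\le\dots\le u(y_{2d})$ are the ordered neighbor values, $H_i[u](x)=\frac12(u(y_{2i-1})+u(y_{2i}))$. For reals $h_1\le\dots\le h_d$ and $\Phi>0$, $T_\Phi(h_1,\dots,h_d)$ denotes the unique number $t<h_1$ with $\prod_{i=1}^d(h_i-t)=\Phi$. The map $T_f$ is defined by $T_f[u](x)=T_{f(x)}(H_1[u](x),\dots,H_d[u](x))$ for $x\in\mathcal U$ and $T_f[u](x)=g(x)$ for $x\in\mathcal O$. A function $u$ is strictly graph convex on $\mathcal U$ if $\frac{u(y)+u(z)}2>u(x)$ for every $x\in\mathcal U$ and all distinct $y,z\in\mathcal N_x$. Barrier: $b\colon\mathcal X\to[0,\infty)$ is a fixed function with $b=0$ on $\mathcal O$, $b>0$ on $\mathcal U$, and $$\max_{\substack{y,z\in\mathcal N_x\\ y\ne z}}\frac{b(y)+b(z)}2\le b(x)-1,\qquad x\in\mathcal U.$$ Such a function exists whenever every nonempty $S\subseteq\mathcal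 U$ contains some $x$ with $|\mathcal N_x\cap S|\le1$. Set $B=\max_{x\in\mathcal U}b(x)$ and, for functions $w\colon\mathcal X\to\mathbb R$ vanishing on $\mathcal O$, $\|w\|_b=\max_{x\in\mathcal U}|w(x)|/b(x)$. *)

theory Defs
  imports "HOL-Analysis.Analysis"
begin

text \<open>
  A finite simple graph is a symmetric irreflexive relation \<open>E\<close> on a finite type \<open>'a\<close>, whose elements
  are the vertices. The set \<open>Ob\<close> carries the boundary values, and the remaining
  vertices form \<open>U = UNIV - Ob\<close>. A function on \<open>Ob\<close> or on \<open>U\<close> is a total function on \<open>'a\<close> of which
  only the values on that set are used.
\<close>

definition nbrs :: "('a \<times> 'a) set \<Rightarrow> 'a \<Rightarrow> 'a set" where
  "nbrs E x = E `` {x}"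

text \<open>Meaningful for \<open>card S \<ge> 2\<close>; otherwise the maximum is over the empty set.\<close>

definition pair_max :: "('a \<Rightarrow> real) \<Rightarrow> 'a set \<Rightarrow> real" where
  "pair_max u S = Max {(u y + u z) / 2 | y z. y \<in> S \<and> z \<in> S \<and> y \<noteq> z}"

text \<open>Meaningful for \<open>1 \<le> i\<close> and \<open>2 * i \<le> card (nbrs E x)\<close>.\<close>

definition H :: "('a \<times> 'a) set \<Rightarrow> nat \<Rightarrow> ('a \<Rightarrow> real) \<Rightarrow> 'a \<Rightarrow> real" where
  "H E i u x = Min {pair_max u S | S. S \<subseteq> nbrs E x \<and> card S = 2 * i}"

text \<open>
  The numbers \<open>h\<^sub>1 \<le> \<dots> \<le> h\<^sub>d\<close> are \<open>h 1, \<dots>, h d\<close>. For such \<open>h\<close>, \<open>d \<ge> 1\<close> and \<open>\<Phi> > 0\<close>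
  there is exactly one \<open>t\<close> as described.
\<close>

definition T_root :: "nat \<Rightarrow> real \<Rightarrow> (nat \<Rightarrow> real) \<Rightarrow> real" where
  "T_root d \<Phi> h = (THE t. t < h 1 \<and> (\<Prod>i=1..d. h i - t) = \<Phi>)"

definition T_map :: "('a \<times> 'a) set \<Rightarrow> 'a set \<Rightarrow> nat \<Rightarrow> ('a \<Rightarrow> real) \<Rightarrow> ('a \<Rightarrow> real)
    \<Rightarrow> ('a \<Rightarrow> real) \<Rightarrow> 'a \<Rightarrow> real" where
  "T_map E Ob d f g u x = (if x \<in> Ob then g x else T_root d (f x) (\<lambda>i. H E i u x))"

definition strictly_graph_convex :: "('a \<times> 'a) set \<Rightarrow> 'a set \<Rightarrow> ('a \<Rightarrow> real) \<Rightarrow> bool" where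
  "strictly_graph_convex E U u \<longleftrightarrow>
     (\<forall>x\<in>U. \<forall>y\<in>nbrs E x. \<forall>z\<in>nbrs E x. y \<noteq> z \<longrightarrow> (u y + u z) / 2 > u x)"

definition solves_dirichlet :: "('a \<times> 'a) set \<Rightarrow> 'a set \<Rightarrow> nat \<Rightarrow> ('a \<Rightarrow> real) \<Rightarrow> ('a \<Rightarrow> real)
    \<Rightarrow> ('a \<Rightarrow> real) \<Rightarrow> bool" where
  "solves_dirichlet E Ob d f g u \<longleftrightarrow>
     (\<forall>x\<in>UNIV - Ob. (\<Prod>i=1..d. H E i u x - u x) = f x) \<and> (\<forall>x\<in>Ob. u x = g x)"

definition is_barrier :: "('a \<times> 'a) set \<Rightarrow> 'a set \<Rightarrow> ('a \<Rightarrow> real) \<Rightarrow> bool" where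
  "is_barrier E Ob b \<longleftrightarrow>
     (\<forall>x\<in>Ob. b x = 0) \<and> (\<forall>x\<in>UNIV - Ob. b x > 0) \<and>
     (\<forall>x\<in>UNIV - Ob. pair_max b (nbrs E x) \<le> b x - 1)"

text \<open>Used only for functions \<open>w\<close> that vanish outside \<open>U\<close>.\<close>

definition barrier_norm :: "'a set \<Rightarrow> ('a \<Rightarrow> real) \<Rightarrow> ('a \<Rightarrow> real) \<Rightarrow> real" where
  "barrier_norm U b w = Max ((\<lambda>x. \<bar>w x\<bar> / b x) ` U)"

definition relaxation_step :: "('a \<times> 'a) set \<Rightarrow> 'a set \<Rightarrow> nat \<Rightarrow> ('a \<Rightarrow> real) \<Rightarrow> ('a \<Rightarrow> real)
    \<Rightarrow> real \<Rightarrow> ('a \<Rightarrow> real) \<Rightarrow> 'a \<Rightarrow> real" where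
  "relaxation_step E Ob d f g \<omega> u x =
     (if x \<in> Ob then g x else (1 - \<omega>) * u x + \<omega> * T_map E Ob d f g u x)"

end

theory Submission
  imports Defs
begin

text \<open>
  If \<open>\<bar>u - v\<bar> \<le> M b\<close>, then each \<open>H\<^sub>i\<close> at \<open>x\<close> changes by at most \<open>M\<close> times the largest pair average
  of \<open>b\<close> over the neighbours, that is, by at most \<open>M (b x - 1) \<le> (1 - 1/B) M b x\<close>. The root
  \<open>T\<^sub>\<Phi>\<close> is monotone in \<open>(h\<^sub>1, \<dots>, h\<^sub>d)\<close> and commutes with adding a constant to all \<open>h\<^sub>i\<close>, so the same
  bound holds for \<open>T\<^sub>f\<close>. The rest is Banach's fixed point argument, and \<open>t < h\<^sub>1\<close> at a fixed point is
  exactly strict graph convexity.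
\<close>

section \<open>Maxima of pair averages\<close>

lemma finite_pair_averages:
  fixes u :: "'a::finite \<Rightarrow> real"
  shows "finite {(u y + u z) / 2 | y z. y \<in> S \<and> z \<in> S \<and> y \<noteq> z}"
  by (rule finite_subset[of _ "(\<lambda>(y, z). (u y + u z) / 2) ` UNIV"]) force+

lemma pair_max_le_iff:
  fixes u :: "'a::finite \<Rightarrow> real"
  assumes "2 \<le> card S"
  shows "pair_max u S \<le> c \<longleftrightarrow> (\<forall>y\<in>S. \<forall>z\<in>S. y \<noteq> z \<longrightarrow> (u y + u z) / 2 \<le> c)"
proof -
  obtain y z where "y \<in> S" "z \<in> S" "y \<noteq> z"
    using assms card_le_Suc0_iff_eq[of S] by (auto simp: not_less_eq_eq)
  then have "{(u y + u z) / 2 | y z. y \<in> S \<and> z \<in> S \<and> y \<noteq> z} \<noteq> {}"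
    by blast
  then show ?thesis
    unfolding pair_max_def by (subst Max_le_iff[OF finite_pair_averages]) blast+
qed

lemma pair_max_doubleton:
  assumes "y \<noteq> z"
  shows "pair_max u {y, z} = (u y + u z) / 2"
proof -
  have "{(u a + u c) / 2 | a c. a \<in> {y, z} \<and> c \<in> {y, z} \<and> a \<noteq> c} = {(u y + u z) / 2}"
  proof (intro equalityI subsetI)
    fix t assume "t \<in> {(u y + u z) / 2}"
    then show "t \<in> {(u a + u c) / 2 | a c. a \<in> {y, z} \<and> c \<in> {y, z} \<and> a \<noteq> c}"
      using assms by blast
  qed (auto simp: add.commute)
  then show ?thesis
    by (simp add: pair_max_def)
qed

lemma pair_max_mono:
  fixes u :: "'a::finite \<Rightarrow> real"
  assumes "S \<subseteq> S'" "2 \<le> card S"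
  shows "pair_max u S \<le> pair_max u S'"
proof -
  have "2 \<le> card S'"
    using assms card_mono[of S' S] by simp
  then show ?thesis
    using pair_max_le_iff[of S' u "pair_max u S'"] assms by (auto simp: pair_max_le_iff)
qed

lemma pair_max_nonneg:
  fixes u :: "'a::finite \<Rightarrow> real"
  assumes "2 \<le> card S" "\<And>y. 0 \<le> u y"
  shows "0 \<le> pair_max u S"
proof -
  obtain y z where yz: "y \<in> S" "z \<in> S" "y \<noteq> z"
    using assms(1) card_le_Suc0_iff_eq[of S] by (auto simp: not_less_eq_eq)
  have "0 \<le> (u y + u z) / 2"
    using assms(2) by simp
  also have "\<dots> \<le> pair_max u S"
    using pair_max_le_iff[OF assms(1), of u "pair_max u S"] yz by blast
  finally show ?thesis .
qed

text \<open>Averaging is linear, so the perturbation of each pair is at most \<open>M\<close> times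
  a pair average of \<open>b\<close>. Taking that maximum over \<open>N\<close> instead of
  \<open>S\<close> makes the error term the same for all \<open>S\<close>, as needed when minimizing
  over \<open>S\<close>.\<close>

lemma pair_max_le_add:
  fixes u :: "'a::finite \<Rightarrow> real"
  assumes "S \<subseteq> N" "2 \<le> card S" "0 \<le> M" "\<And>y. u y \<le> v y + M * b y"
  shows "pair_max u S \<le> pair_max v S + M * pair_max b N"
  unfolding pair_max_le_iff[OF assms(2)]
proof (intro ballI impI)
  fix y z assume yz: "y \<in> S" "z \<in> S" "y \<noteq> z"
  have "(v y + v z) / 2 \<le> pair_max v S"
    using pair_max_le_iff[OF assms(2), of v "pair_max v S"] yz by blast
  moreover have "(b y + b z) / 2 \<le> pair_max b N"
    using pair_max_le_iff[OF assms(2), of b "pair_max b S"] yz pair_max_mono[OF assms(1,2), of b]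
    by fastforce
  then have "M * ((b y + b z) / 2) \<le> M * pair_max b N"
    using assms(3) by (rule mult_left_mono)
  moreover have "(u y + u z) / 2 \<le> (v y + v z) / 2 + M * ((b y + b z) / 2)"
    using assms(4)[of y] assms(4)[of z] by (simp add: field_simps)
  ultimately show "(u y + u z) / 2 \<le> pair_max v S + M * pair_max b N"
    by linarith
qed

section \<open>The operators \<open>H E i\<close>\<close>

lemma finite_pair_max_values:
  fixes u :: "'a::finite \<Rightarrow> real"
  shows "finite {pair_max u S | S. S \<subseteq> nbrs E x \<and> card S = k}"
  by (rule finite_subset[of _ "pair_max u ` UNIV"]) auto

text \<open>The cardinality bound provides an admissible \<open>S\<close>, so \<open>Min\<close>
  ranges over a nonempty finite set and is a genuine minimum.\<close>

lemma
  fixes u :: "'a::finite \<Rightarrow> real"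
  assumes "2 * i \<le> card (nbrs E x)"
  shows le_H_iff: "c \<le> H E i u x \<longleftrightarrow> (\<forall>S\<subseteq>nbrs E x. card S = 2 * i \<longrightarrow> c \<le> pair_max u S)"
    and less_H_iff: "c < H E i u x \<longleftrightarrow> (\<forall>S\<subseteq>nbrs E x. card S = 2 * i \<longrightarrow> c < pair_max u S)"
proof -
  obtain S where "S \<subseteq> nbrs E x" "card S = 2 * i"
    using obtain_subset_with_card_n[OF assms] by blast
  then have ne: "{pair_max u S | S. S \<subseteq> nbrs E x \<and> card S = 2 * i} \<noteq> {}"
    by blast
  show "c \<le> H E i u x \<longleftrightarrow> (\<forall>S\<subseteq>nbrs E x. card S = 2 * i \<longrightarrow> c \<le> pair_max u S)"
    unfolding H_def by (subst Min_ge_iff[OF finite_pair_max_values ne]) blast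
  show "c < H E i u x \<longleftrightarrow> (\<forall>S\<subseteq>nbrs E x. card S = 2 * i \<longrightarrow> c < pair_max u S)"
    unfolding H_def by (subst Min_gr_iff[OF finite_pair_max_values ne]) blast
qed

lemma H_le_add:
  fixes u :: "'a::finite \<Rightarrow> real"
  assumes i: "1 \<le> i" "2 * i \<le> card (nbrs E x)"
    and "0 \<le> M" "\<And>y. u y \<le> v y + M * b y"
  shows "H E i u x \<le> H E i v x + M * pair_max b (nbrs E x)"
proof -
  have "H E i u x - M * pair_max b (nbrs E x) \<le> pair_max v S"
    if S: "S \<subseteq> nbrs E x" "card S = 2 * i" for S
  proof -
    have "H E i u x \<le> pair_max u S"
      using le_H_iff[OF i(2), of "H E i u x" u] S by blast
    also have "\<dots> \<le> pair_max v S + M * pair_max b (nbrs E x)"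
      using S i(1) assms(3,4) by (intro pair_max_le_add) auto
    finally show ?thesis
      by simp
  qed
  then have "H E i u x - M * pair_max b (nbrs E x) \<le> H E i v x"
    using le_H_iff[OF i(2)] by blast
  then show ?thesis
    by simp
qed

text \<open>Every set of \<open>2 * j\<close> neighbors contains one of \<open>2 * i\<close>
  neighbors, and \<open>pair_max\<close> grows with the set. This supplies the condition
  \<open>h 1 \<le> h i\<close> under which \<open>T_root\<close> is well defined.\<close>

lemma H_mono:
  fixes u :: "'a::finite \<Rightarrow> real"
  assumes "1 \<le> i" "i \<le> j" "2 * j \<le> card (nbrs E x)"
  shows "H E i u x \<le> H E j u x"
proof -
  have i: "2 * i \<le> card (nbrs E x)"
    using assms(2,3) by simp
  have "H E i u x \<le> pair_max u S" if S: "S \<subseteq> nbrs E x" "card S = 2 * j" for S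
  proof -
    obtain S' where S': "S' \<subseteq> S" "card S' = 2 * i"
      using obtain_subset_with_card_n[of "2 * i" S] S assms(2) by auto
    have "H E i u x \<le> pair_max u S'"
      using le_H_iff[OF i, of "H E i u x" u] S' S by blast
    also have "\<dots> \<le> pair_max u S"
      using S' assms(1) by (intro pair_max_mono) auto
    finally show ?thesis .
  qed
  then show ?thesis
    using le_H_iff[OF assms(3)] by blast
qed

text \<open>The two-element subsets are exactly the pairs of distinct neighbors. This turns the side
  condition \<open>t < h 1\<close> of the root into strict graph convexity at
  \<open>x\<close>.\<close>

lemma less_H_1_iff:
  fixes u :: "'a::finite \<Rightarrow> real"
  assumes "2 \<le> card (nbrs E x)"
  shows "c < H E 1 u x \<longleftrightarrow> (\<forall>y\<in>nbrs E x. \<forall>z\<in>nbrs E x. y \<noteq> z \<longrightarrow> c < (u y + u z) / 2)"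
proof -
  have "c < H E 1 u x \<longleftrightarrow> (\<forall>S\<subseteq>nbrs E x. card S = 2 \<longrightarrow> c < pair_max u S)"
    using less_H_iff[of 1] assms by simp
  also have "\<dots> \<longleftrightarrow> (\<forall>y\<in>nbrs E x. \<forall>z\<in>nbrs E x. y \<noteq> z \<longrightarrow> c < pair_max u {y, z})"
  proof
    assume L: "\<forall>S\<subseteq>nbrs E x. card S = 2 \<longrightarrow> c < pair_max u S"
    show "\<forall>y\<in>nbrs E x. \<forall>z\<in>nbrs E x. y \<noteq> z \<longrightarrow> c < pair_max u {y, z}"
      using L by simp
  qed (auto simp: card_2_iff)
  also have "\<dots> \<longleftrightarrow> (\<forall>y\<in>nbrs E x. \<forall>z\<in>nbrs E x. y \<noteq> z \<longrightarrow> c < (u y + u z) / 2)"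
    by (auto simp: pair_max_doubleton)
  finally show ?thesis .
qed

section \<open>The root of the product equation\<close>

text \<open>If \<open>t > s + c\<close>, every factor \<open>h i - t\<close> is positive and
  strictly below \<open>k i - s\<close>, so the products cannot agree. Uniqueness of the root
  (\<open>h = k\<close>, \<open>c = 0\<close>) and its monotonicity under shifts are both
  instances.\<close>

lemma prod_root_le:
  fixes h k :: "nat \<Rightarrow> real"
  assumes "1 \<le> d" "\<And>i. i \<in> {1..d} \<Longrightarrow> t < h i" "\<And>i. i \<in> {1..d} \<Longrightarrow> h i \<le> k i + c"
    and "(\<Prod>i=1..d. h i - t) = (\<Prod>i=1..d. k i - s)"
  shows "t \<le> s + c"
proof (rule ccontr)
  assume "\<not> t \<le> s + c"
  then have step: "0 < h i - t" "h i - t < k i - s" if "i \<in> {1..d}" for i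
    using assms(2,3)[OF that] by simp_all
  have "(\<Prod>i=1..d. h i - t) < (\<Prod>i=1..d. k i - s)"
  proof (rule prod_mono_strict)
    show "1 \<in> {1..d}" "h 1 - t < k 1 - s"
      using assms(1) step(2)[of 1] by auto
    show "0 \<le> h i - t \<and> h i - t \<le> k i - s" "0 < k i - s" if "i \<in> {1..d}" for i
      using step[OF that] by auto
  qed simp
  then show False
    using assms(4) by simp
qed

lemma T_root_exists:
  fixes h :: "nat \<Rightarrow> real"
  assumes "1 \<le> d" "0 < \<Phi>" "\<And>i. i \<in> {1..d} \<Longrightarrow> h 1 \<le> h i"
  shows "\<exists>t < h 1. (\<Prod>i=1..d. h i - t) = \<Phi>"
proof -
  \<comment> \<open>With \<open>c \<ge> 1\<close> and \<open>c \<ge> \<Phi>\<close>, each factor at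
    \<open>t = h 1 - c\<close> is at least \<open>c\<close>, so the product there is at least
    \<open>c ^ d \<ge> c \<ge> \<Phi>\<close>. It vanishes at \<open>t = h 1\<close>, and the
    intermediate value theorem applies in between.\<close>
  define c where "c = max 1 \<Phi>"
  have zero: "(\<Prod>i=1..d. h i - h 1) = 0"
    using assms(1) by (intro prod_zero) auto
  have "\<Phi> \<le> c ^ 1"
    by (simp add: c_def)
  also have "\<dots> \<le> c ^ d"
    using assms(1) by (intro power_increasing) (auto simp: c_def)
  also have "c ^ d = (\<Prod>i=1..d. c)"
    by simp
  also have "\<dots> \<le> (\<Prod>i=1..d. h i - (h 1 - c))"
    using assms(3) by (intro prod_mono) (fastforce simp: c_def)
  finally have "\<Phi> \<le> (\<Prod>i=1..d. h i - (h 1 - c))" .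
  moreover have "h 1 - c \<le> h 1"
    by (simp add: c_def)
  moreover have "continuous_on {h 1 - c..h 1} (\<lambda>t. \<Prod>i=1..d. h i - t)"
    by (intro continuous_intros)
  moreover have "(\<Prod>i=1..d. h i - h 1) \<le> \<Phi>"
    unfolding zero using assms(2) by simp
  ultimately obtain t where t: "t \<le> h 1" "(\<Prod>i=1..d. h i - t) = \<Phi>"
    using IVT2'[of "\<lambda>t. \<Prod>i=1..d. h i - t" "h 1" \<Phi> "h 1 - c"] by blast
  moreover have "t \<noteq> h 1"
    using t(2) zero assms(2) by (metis less_irrefl)
  ultimately show ?thesis
    by force
qed

lemma T_root_unique:
  fixes h :: "nat \<Rightarrow> real"
  assumes "1 \<le> d" "\<And>i. i \<in> {1..d} \<Longrightarrow> h 1 \<le> h i"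
    and "t < h 1" "s < h 1" "(\<Prod>i=1..d. h i - t) = (\<Prod>i=1..d. h i - s)"
  shows "t = s"
proof (rule antisym)
  show "t \<le> s"
    using prod_root_le[of d t h h 0 s] assms by force
  show "s \<le> t"
    using prod_root_le[of d s h h 0 t] assms by force
qed

text \<open>Existence and uniqueness remove the definite description. The left-to-right direction
  gives the defining property of the root, and the equivalence as a whole serves as the fixed point
  test for \<open>T_map\<close>.\<close>

lemma T_root_eq_iff:
  assumes "1 \<le> d" "0 < \<Phi>" "\<And>i. i \<in> {1..d} \<Longrightarrow> h 1 \<le> h i"
  shows "T_root d \<Phi> h = t \<longleftrightarrow> t < h 1 \<and> (\<Prod>i=1..d. h i - t) = \<Phi>"
proof -
  have ex1: "\<exists>!t. t < h 1 \<and> (\<Prod>i=1..d. h i - t) = \<Phi>"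
    using T_root_exists[of d \<Phi> h] T_root_unique[of d h] assms by metis
  show ?thesis
    unfolding T_root_def using theI'[OF ex1] the1_equality[OF ex1] by blast
qed

text \<open>Both products equal the same \<open>\<Phi>\<close>, so \<open>prod_root_le\<close>
  compares the two roots directly; monotonicity and translation need not be separated.\<close>

lemma T_root_le_add:
  assumes "1 \<le> d" "0 < \<Phi>" "\<And>i. i \<in> {1..d} \<Longrightarrow> h 1 \<le> h i" "\<And>i. i \<in> {1..d} \<Longrightarrow> k 1 \<le> k i"
    and "\<And>i. i \<in> {1..d} \<Longrightarrow> h i \<le> k i + c"
  shows "T_root d \<Phi> h \<le> T_root d \<Phi> k + c"
proof (rule prod_root_le[where h = h and k = k])
  have h: "T_root d \<Phi> h < h 1" "(\<Prod>i=1..d. h i - T_root d \<Phi> h) = \<Phi>"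
    using T_root_eq_iff[of d \<Phi> h] assms by blast+
  moreover have "(\<Prod>i=1..d. k i - T_root d \<Phi> k) = \<Phi>"
    using T_root_eq_iff[of d \<Phi> k] assms by blast
  ultimately show "(\<Prod>i=1..d. h i - T_root d \<Phi> h) = (\<Prod>i=1..d. k i - T_root d \<Phi> k)"
    by simp
  show "T_root d \<Phi> h < h i" if "i \<in> {1..d}" for i
    using h(1) assms(3)[OF that] by linarith
qed (use assms in auto)

section \<open>The barrier and the map \<open>T_map\<close>\<close>

lemma barrier_norm_le_iff:
  fixes w :: "'a::finite \<Rightarrow> real"
  assumes "U \<noteq> {}" "\<And>x. x \<in> U \<Longrightarrow> 0 < b x"
  shows "barrier_norm U b w \<le> M \<longleftrightarrow> (\<forall>x\<in>U. \<bar>w x\<bar> \<le> M * b x)"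
  unfolding barrier_norm_def using assms by (subst Max_le_iff) (auto simp: pos_divide_le_eq)

text \<open>As \<open>b\<close> is nonnegative everywhere, so is its pair maximum, and the barrier
  inequality leaves at least 1 for \<open>b x\<close>.\<close>

lemma barrier_ge_one:
  fixes b :: "'a::finite \<Rightarrow> real"
  assumes "is_barrier E Ob b" "x \<notin> Ob" "2 \<le> card (nbrs E x)"
  shows "1 \<le> b x"
proof -
  have "0 \<le> b y" for y
    using assms(1) unfolding is_barrier_def by (cases "y \<in> Ob") (auto intro: less_imp_le)
  then have "0 \<le> pair_max b (nbrs E x)"
    using assms(3) by (intro pair_max_nonneg) auto
  then show ?thesis
    using assms(1,2) unfolding is_barrier_def by force
qed

text \<open>A one-sided estimate: exchanging \<open>u\<close> and \<open>v\<close> gives the bound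
  on the absolute difference.\<close>

lemma T_map_diff_le:
  fixes u :: "'a::finite \<Rightarrow> real"
  assumes "x \<notin> Ob" "1 \<le> d" "card (nbrs E x) = 2 * d" "0 < f x"
    and b: "is_barrier E Ob b" "b x \<le> B"
    and M: "0 \<le> M" "\<And>y. u y \<le> v y + M * b y"
  shows "T_map E Ob d f g u x \<le> T_map E Ob d f g v x + (1 - 1 / B) * M * b x"
proof -
  have "T_root d (f x) (\<lambda>i. H E i u x)
      \<le> T_root d (f x) (\<lambda>i. H E i v x) + M * pair_max b (nbrs E x)"
    using assms by (intro T_root_le_add H_mono H_le_add) auto
  also have "M * pair_max b (nbrs E x) \<le> M * (b x - 1)"
    using b(1) assms(1) M(1) unfolding is_barrier_def by (intro mult_left_mono) auto
  \<comment> \<open>The absolute gain 1 from the barrier becomes the relative gain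
    \<open>1 / B\<close>, since \<open>b x / B \<le> 1\<close>. The bound \<open>1 \<le> b x\<close>
    ensures that \<open>B\<close> is positive.\<close>
  also have "M * (b x - 1) \<le> M * (b x - b x / B)"
  proof -
    have "1 \<le> b x"
      using assms by (intro barrier_ge_one) auto
    then have "b x / B \<le> 1"
      using b(2) by simp
    then show ?thesis
      using M(1) by (intro mult_left_mono) auto
  qed
  also have "M * (b x - b x / B) = (1 - 1 / B) * M * b x"
    by (simp add: algebra_simps)
  finally show ?thesis
    using assms(1) by (simp add: T_map_def)
qed

lemma T_map_fixed_iff:
  fixes u :: "'a::finite \<Rightarrow> real"
  assumes "1 \<le> d" "\<And>x. x \<in> UNIV - Ob \<Longrightarrow> card (nbrs E x) = 2 * d"
    and "\<And>x. x \<in> UNIV - Ob \<Longrightarrow> 0 < f x"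
  shows "T_map E Ob d f g u = u
    \<longleftrightarrow> solves_dirichlet E Ob d f g u \<and> strictly_graph_convex E (UNIV - Ob) u"
proof -
  have inner: "T_map E Ob d f g u x = u x \<longleftrightarrow> (\<Prod>i=1..d. H E i u x - u x) = f x \<and>
      (\<forall>y\<in>nbrs E x. \<forall>z\<in>nbrs E x. y \<noteq> z \<longrightarrow> u x < (u y + u z) / 2)" if "x \<in> UNIV - Ob" for x
  proof -
    have "T_root d (f x) (\<lambda>i. H E i u x) = u x
        \<longleftrightarrow> u x < H E 1 u x \<and> (\<Prod>i=1..d. H E i u x - u x) = f x"
      using assms(1) assms(2,3)[OF that] by (intro T_root_eq_iff H_mono) auto
    moreover have "2 \<le> card (nbrs E x)"
      using assms(1) assms(2)[OF that] by simp
    ultimately show ?thesis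
      using that less_H_1_iff by (auto simp: T_map_def)
  qed
  have "T_map E Ob d f g u = u \<longleftrightarrow>
      (\<forall>x\<in>UNIV - Ob. T_map E Ob d f g u x = u x) \<and> (\<forall>x\<in>Ob. T_map E Ob d f g u x = u x)"
    by (auto simp: fun_eq_iff)
  also have "(\<forall>x\<in>Ob. T_map E Ob d f g u x = u x) \<longleftrightarrow> (\<forall>x\<in>Ob. u x = g x)"
    by (auto simp: T_map_def)
  also have "(\<forall>x\<in>UNIV - Ob. T_map E Ob d f g u x = u x) \<longleftrightarrow>
      (\<forall>x\<in>UNIV - Ob. (\<Prod>i=1..d. H E i u x - u x) = f x) \<and>
      strictly_graph_convex E (UNIV - Ob) u"
    unfolding strictly_graph_convex_def by (simp add: inner ball_conj_distrib)
  finally show ?thesis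
    unfolding solves_dirichlet_def by blast
qed

section \<open>Fixed points of weighted contractions\<close>

text \<open>Banach's argument with pointwise bounds \<open>M * b x\<close> in place of a norm, so
  that only limits of real sequences are taken, one for each \<open>x\<close>.\<close>

lemma weighted_contraction_fixed_point:
  fixes F :: "('a \<Rightarrow> real) \<Rightarrow> 'a \<Rightarrow> real"
  assumes q: "0 \<le> q" "q < 1"
    and contr: "\<And>u v M x. \<lbrakk>\<forall>x\<in>Ob. u x = g x; \<forall>x\<in>Ob. v x = g x; \<forall>x. \<bar>u x - v x\<bar> \<le> M * b x\<rbrakk>
      \<Longrightarrow> \<bar>F u x - F v x\<bar> \<le> q * M * b x"
    and bdry: "\<And>u x. x \<in> Ob \<Longrightarrow> F u x = g x"
    and start: "\<forall>x\<in>Ob. u0 x = g x" "\<And>x. \<bar>F u0 x - u0 x\<bar> \<le> D * b x"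
  shows "\<exists>u. F u = u"
proof -
  define s where "s m = (F ^^ m) u0" for m
  \<comment> \<open>The sum of the geometric series with first term \<open>D\<close> and ratio
    \<open>q\<close>. The identity \<open>q * K + D = K\<close> keeps the distance bound from
    \<open>s 0\<close> invariant in the induction below.\<close>
  define K where "K = D / (1 - q)"
  have K: "q * K + D = K"
    using q(2) by (simp add: K_def field_simps)
  have s_Suc: "s (Suc m) = F (s m)" for m
    by (simp add: s_def)
  have s_bdry: "\<forall>x\<in>Ob. s m x = g x" for m
    using start(1) by (cases m) (auto simp: s_def bdry)
  have init: "\<forall>x. \<bar>s k x - s 0 x\<bar> \<le> K * b x" for k
  proof (induction k)
    case 0
    \<comment> \<open>No sign is assumed for \<open>D\<close> or \<open>b\<close>; the product
      \<open>D * b x\<close> is nonnegative because it bounds an absolute value.\<close>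
    have "0 \<le> D * b x / (1 - q)" for x
      using start(2)[of x] q(2) by (intro divide_nonneg_pos) auto
    then show ?case
      by (simp add: K_def)
  next
    case (Suc k)
    show ?case
    proof
      fix x
      have "\<bar>F (s k) x - F (s 0) x\<bar> \<le> q * K * b x"
        using Suc by (intro contr s_bdry)
      moreover have "\<bar>F (s 0) x - s 0 x\<bar> \<le> D * b x"
        using start(2) by (simp add: s_def)
      moreover have "K * b x = q * K * b x + D * b x"
        by (subst K[symmetric]) (simp add: algebra_simps)
      ultimately show "\<bar>s (Suc k) x - s 0 x\<bar> \<le> K * b x"
        unfolding s_Suc by linarith
    qed
  qed
  \<comment> \<open>Applying the contraction \<open>m\<close> times carries the pair
    \<open>s k\<close>, \<open>s 0\<close> to \<open>s (m + k)\<close>, \<open>s m\<close>. The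
    bound is uniform in \<open>k\<close>, which gives the Cauchy property and survives the limit in
    \<open>k\<close>.\<close>
  have tail: "\<forall>x. \<bar>s (m + k) x - s m x\<bar> \<le> q ^ m * K * b x" for m k
  proof (induction m)
    case 0
    then show ?case
      using init by simp
  next
    case (Suc m)
    then show ?case
      using contr[OF s_bdry s_bdry Suc] by (simp add: s_Suc mult.assoc)
  qed
  have geom: "(\<lambda>m. q ^ m * K * b x) \<longlonglongrightarrow> 0" for x
    using q by (intro tendsto_mult_left_zero LIMSEQ_power_zero) simp
  have "Cauchy (\<lambda>m. s m x)" for x
  proof (rule CauchyI')
    fix e :: real assume "0 < e"
    then obtain m0 where m0: "\<And>m. m \<ge> m0 \<Longrightarrow> norm (q ^ m * K * b x - 0) < e"
      using LIMSEQ_D[OF geom] by meson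
    have "dist (s m x) (s n x) < e" if "m \<ge> m0" "n > m" for m n
    proof -
      have "\<bar>s n x - s m x\<bar> \<le> q ^ m * K * b x"
        using tail[of m "n - m"] that(2) by simp
      then show ?thesis
        using m0[OF that(1)] by (simp add: dist_real_def)
    qed
    then show "\<exists>M. \<forall>m\<ge>M. \<forall>n>m. dist (s m x) (s n x) < e"
      by blast
  qed
  then have "\<exists>l. (\<lambda>m. s m x) \<longlonglongrightarrow> l" for x
    by (simp add: real_Cauchy_convergent convergent_def[symmetric])
  then obtain L where L: "\<And>x. (\<lambda>m. s m x) \<longlonglongrightarrow> L x"
    by metis
  have L_tail: "\<forall>x. \<bar>L x - s m x\<bar> \<le> q ^ m * K * b x" for m
  proof
    fix x
    have "(\<lambda>k. \<bar>s (k + m) x - s m x\<bar>) \<longlonglongrightarrow> \<bar>L x - s m x\<bar>"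
      by (intro tendsto_intros LIMSEQ_ignore_initial_segment L)
    then show "\<bar>L x - s m x\<bar> \<le> q ^ m * K * b x"
      by (rule LIMSEQ_le_const2) (use tail[of m] in \<open>simp add: add.commute[of _ m]\<close>)
  qed
  have L_bdry: "\<forall>x\<in>Ob. L x = g x"
  proof
    fix x assume "x \<in> Ob"
    then have "(\<lambda>m. s m x) \<longlonglongrightarrow> g x"
      using s_bdry by simp
    then show "L x = g x"
      using L LIMSEQ_unique by blast
  qed
  \<comment> \<open>The contraction estimate between \<open>L\<close> and \<open>s m\<close> acts as
    continuity of \<open>F\<close>: the shifted sequence tends both to \<open>F L x\<close> and to
    \<open>L x\<close>.\<close>
  have "F L x = L x" for x
  proof -
    have "\<forall>m. norm (s (Suc m) x - F L x) \<le> q * (q ^ m * K * b x)"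
      using contr[OF L_bdry s_bdry L_tail] by (simp add: s_Suc abs_minus_commute mult.assoc)
    then have "(\<lambda>m. s (Suc m) x - F L x) \<longlonglongrightarrow> 0"
      by (intro Lim_null_comparison[OF _ tendsto_mult_right_zero[OF geom]] always_eventually)
    then have "(\<lambda>m. s (Suc m) x) \<longlonglongrightarrow> F L x"
      by (simp add: LIM_zero_iff)
    moreover have "(\<lambda>m. s (Suc m) x) \<longlonglongrightarrow> L x"
      using L by (rule LIMSEQ_Suc)
    ultimately show ?thesis
      using LIMSEQ_unique by blast
  qed
  then show ?thesis
    by blast
qed

section \<open>Contraction of \<open>T_map\<close> and convergence of the relaxed iteration\<close>

theorem theorem6p5:
  fixes E :: "('a::finite \<times> 'a) set" and Ob U :: "'a set" and d :: nat
    and f g b :: "'a \<Rightarrow> real" and B :: real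
  assumes "sym E" and "irrefl E"
    and "U = UNIV - Ob" and "U \<noteq> {}"
    and "d \<ge> 1"
    and "\<And>S. S \<subseteq> U \<Longrightarrow> S \<noteq> {} \<Longrightarrow> \<exists>x\<in>S. card (nbrs E x \<inter> S) \<le> 1"
    and "\<And>x. x \<in> U \<Longrightarrow> card (nbrs E x) = 2 * d"
    and "\<And>x. x \<in> U \<Longrightarrow> f x > 0"
    and "is_barrier E Ob b"
    and "B = Max (b ` U)"
  shows "(\<forall>u v. (\<forall>x\<in>Ob. u x = g x) \<longrightarrow> (\<forall>x\<in>Ob. v x = g x) \<longrightarrow>
            barrier_norm U b (\<lambda>x. T_map E Ob d f g u x - T_map E Ob d f g v x)
              \<le> (1 - 1 / B) * barrier_norm U b (\<lambda>x. u x - v x)) \<and>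
         (\<exists>ustar.
            (\<forall>u. T_map E Ob d f g u = u \<longleftrightarrow> u = ustar) \<and>
            (\<forall>u. solves_dirichlet E Ob d f g u \<and> strictly_graph_convex E U u \<longleftrightarrow> u = ustar) \<and>
            (\<forall>\<omega> u0. 0 < \<omega> \<longrightarrow> \<omega> \<le> 1 \<longrightarrow> (\<forall>x\<in>Ob. u0 x = g x) \<longrightarrow>
               (\<forall>x. (\<lambda>m. (relaxation_step E Ob d f g \<omega> ^^ m) u0 x) \<longlonglongrightarrow> ustar x) \<and>
               (\<forall>m. barrier_norm U b (\<lambda>x. (relaxation_step E Ob d f g \<omega> ^^ m) u0 x - ustar x)
                      \<le> (1 - \<omega> / B) ^ m * barrier_norm U b (\<lambda>x. u0 x - ustar x))))"
proof -
  let ?T = "T_map E Ob d f g" and ?n = "barrier_norm U b"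
  define q where "q = 1 - 1 / B"
  have b_pos: "0 < b x" if "x \<in> U" for x
    using assms(3,9) that by (auto simp: is_barrier_def)
  have b_zero: "b x = 0" if "x \<in> Ob" for x
    using assms(9) that by (auto simp: is_barrier_def)
  have b_le: "b x \<le> B" if "x \<in> U" for x
    using that by (simp add: assms(10))
  obtain x0 where "x0 \<in> U"
    using assms(4) by blast
  have "1 \<le> b x0"
    using \<open>x0 \<in> U\<close> assms(3,5,7,9) by (intro barrier_ge_one[of E Ob]) auto
  then have B: "1 \<le> B"
    using b_le[OF \<open>x0 \<in> U\<close>] by simp
  then have q: "0 \<le> q" "q < 1"
    by (auto simp: q_def)
  have le_norm_iff: "?n w \<le> M \<longleftrightarrow> (\<forall>x\<in>U. \<bar>w x\<bar> \<le> M * b x)" for w M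
    using barrier_norm_le_iff[OF assms(4), of b] b_pos by blast
  \<comment> \<open>On \<open>Ob\<close> both the difference and \<open>b\<close> vanish, so the
    norm bound on \<open>U\<close> extends to all vertices, the form used by the fixed point
    lemma.\<close>
  have norm_iff: "?n (\<lambda>x. u x - v x) \<le> M \<longleftrightarrow> (\<forall>x. \<bar>u x - v x\<bar> \<le> M * b x)"
    if "\<forall>x\<in>Ob. u x = g x" "\<forall>x\<in>Ob. v x = g x" for u v M
    unfolding le_norm_iff using that b_zero by (auto simp: assms(3))
  have bdry: "?T u x = g x" if "x \<in> Ob" for u x
    using that by (simp add: T_map_def)
  have contr: "\<bar>?T u x - ?T v x\<bar> \<le> q * M * b x"
    if "\<forall>x\<in>Ob. u x = g x" "\<forall>x\<in>Ob. v x = g x" and M: "\<forall>x. \<bar>u x - v x\<bar> \<le> M * b x" for u v M x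
  proof (cases "x \<in> Ob")
    case True
    then show ?thesis
      by (simp add: bdry b_zero)
  next
    case False
    then have "x \<in> U"
      by (simp add: assms(3))
    \<comment> \<open>\<open>M\<close> is an arbitrary real; the bound at \<open>x0\<close>, where
      \<open>b\<close> is positive, forces it to be nonnegative.\<close>
    have "0 \<le> M * b x0"
      using M[rule_format, of x0] by linarith
    then have "0 \<le> M"
      using b_pos[OF \<open>x0 \<in> U\<close>] by (simp add: zero_le_mult_iff)
    have M': "u y \<le> v y + M * b y" "v y \<le> u y + M * b y" for y
      using M[rule_format, of y] by linarith+
    note T = T_map_diff_le[of x Ob d E f b B M, OF False assms(5) assms(7,8)[OF \<open>x \<in> U\<close>] assms(9)
        b_le[OF \<open>x \<in> U\<close>] \<open>0 \<le> M\<close>]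
    show ?thesis
      using T[of u v g, OF M'(1)] T[of v u g, OF M'(2)] unfolding q_def by linarith
  qed
  have first: "?n (\<lambda>x. ?T u x - ?T v x) \<le> q * ?n (\<lambda>x. u x - v x)"
    if "\<forall>x\<in>Ob. u x = g x" "\<forall>x\<in>Ob. v x = g x" for u v
    using contr[OF that] norm_iff[OF that, of "?n (\<lambda>x. u x - v x)"] by (auto simp: le_norm_iff)
  have "\<exists>us. ?T us = us"
  \<comment> \<open>The orbit starts at \<open>g\<close> itself, which has the right boundary
    values; \<open>D\<close> is the norm of its first displacement.\<close>
  proof (rule weighted_contraction_fixed_point[OF q,
        where F = ?T and Ob = Ob and g = g and ?u0.0 = g])
    show "\<bar>?T g x - g x\<bar> \<le> ?n (\<lambda>x. ?T g x - g x) * b x" for x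
      using norm_iff[of "?T g" g "?n (\<lambda>x. ?T g x - g x)"] bdry by auto
  qed (use contr bdry in auto)
  then obtain us where us: "?T us = us" ..
  have us_bdry: "\<forall>x\<in>Ob. us x = g x"
    using us bdry by metis
  have uniq: "?T u = u \<longleftrightarrow> u = us" for u
  proof
    assume u: "?T u = u"
    then have u_bdry: "\<forall>x\<in>Ob. u x = g x"
      using bdry by metis
    have "?n (\<lambda>x. u x - us x) \<le> q * ?n (\<lambda>x. u x - us x)"
      using first[OF u_bdry us_bdry] u us by simp
    then have "(1 - q) * ?n (\<lambda>x. u x - us x) \<le> 0"
      by (simp add: algebra_simps)
    then have "?n (\<lambda>x. u x - us x) \<le> 0"
      using q(2) by (simp add: mult_le_0_iff)
    then show "u = us"
      using norm_iff[OF u_bdry us_bdry] by auto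
  qed (use us in simp)
  have dirichlet: "solves_dirichlet E Ob d f g u \<and> strictly_graph_convex E U u \<longleftrightarrow> u = us" for u
    using T_map_fixed_iff[of d Ob E f g u] uniq assms(3,5,7,8) by auto
  have iter: "(\<forall>x. (\<lambda>m. (relaxation_step E Ob d f g \<omega> ^^ m) u0 x) \<longlonglongrightarrow> us x) \<and>
      (\<forall>m. ?n (\<lambda>x. (relaxation_step E Ob d f g \<omega> ^^ m) u0 x - us x)
        \<le> (1 - \<omega> / B) ^ m * ?n (\<lambda>x. u0 x - us x))"
    if \<omega>: "0 < \<omega>" "\<omega> \<le> 1" and u0: "\<forall>x\<in>Ob. u0 x = g x" for \<omega> u0
  proof -
    define s where "s m = (relaxation_step E Ob d f g \<omega> ^^ m) u0" for m
    define N where "N = ?n (\<lambda>x. u0 x - us x)"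
    define r where "r = 1 - \<omega> / B"
    \<comment> \<open>The rate is the convex combination of the factor 1 of the identity and the
      factor \<open>q\<close> of \<open>T_map\<close>.\<close>
    have r: "0 \<le> r" "r < 1" "r = (1 - \<omega>) + \<omega> * q"
      using \<omega> B by (auto simp: r_def q_def field_simps)
    have s_bdry: "\<forall>x\<in>Ob. s m x = g x" for m
      using u0 by (cases m) (auto simp: s_def relaxation_step_def)
    have bound: "\<forall>x. \<bar>s m x - us x\<bar> \<le> r ^ m * N * b x" for m
    proof (induction m)
      case 0
      then show ?case
        using norm_iff[OF u0 us_bdry, of N] by (simp add: s_def N_def)
    next
      case (Suc m)
      show ?case
      proof
        fix x
        show "\<bar>s (Suc m) x - us x\<bar> \<le> r ^ Suc m * N * b x"
        proof (cases "x \<in> Ob")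
          case True
          then show ?thesis
            using s_bdry us_bdry b_zero by simp
        next
          case False
          let ?M = "r ^ m * N"
          have "s (Suc m) x = (1 - \<omega>) * s m x + \<omega> * ?T (s m) x"
            using False by (simp add: s_def relaxation_step_def)
          \<comment> \<open>The fixed point equation lets \<open>us x\<close> be split as
            \<open>(1 - \<omega>) * us x + \<omega> * ?T us x\<close>, matching the relaxation step
            term by term.\<close>
          then have "\<bar>s (Suc m) x - us x\<bar>
              = \<bar>(1 - \<omega>) * (s m x - us x) + \<omega> * (?T (s m) x - ?T us x)\<bar>"
            by (simp add: us algebra_simps)
          also have "\<dots> \<le> (1 - \<omega>) * \<bar>s m x - us x\<bar> + \<omega> * \<bar>?T (s m) x - ?T us x\<bar>"
            using \<omega> by (intro order_trans[OF abs_triangle_ineq]) (simp add: abs_mult)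
          also have "\<dots> \<le> (1 - \<omega>) * (?M * b x) + \<omega> * (q * ?M * b x)"
            using \<omega> Suc contr[OF s_bdry us_bdry Suc, of x] by (intro add_mono mult_left_mono) auto
          also have "\<dots> = r ^ Suc m * N * b x"
            by (simp add: r(3) algebra_simps)
          finally show ?thesis .
        qed
      qed
    qed
    have "(\<lambda>m. s m x) \<longlonglongrightarrow> us x" for x
    proof -
      have "(\<lambda>m. r ^ m * N * b x) \<longlonglongrightarrow> 0"
        using r(1,2) by (intro tendsto_mult_left_zero LIMSEQ_power_zero) simp
      then have "(\<lambda>m. s m x - us x) \<longlonglongrightarrow> 0"
        by (rule Lim_null_comparison[rotated]) (use bound in simp)
      then show ?thesis
        by (simp add: LIM_zero_iff)
    qed
    moreover have "?n (\<lambda>x. s m x - us x) \<le> r ^ m * N" for m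
      using norm_iff[OF s_bdry us_bdry] bound by blast
    ultimately show ?thesis
      unfolding s_def N_def r_def by blast
  qed
  show ?thesis
    using first uniq dirichlet iter unfolding q_def by blast
qed

end
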